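(* Bipartite entanglement witnesses can be used to detect multipartite entangled states nonlinearly, in the following sense. There exist an integer $n\ge 3$, an integer $d\ge 2$, bipartite entanglement witnesses $W_1,\dots,W_n$ on $\mathbb{C}^d\otimes\mathbb{C}^d$, and an entangled $n$-partite state $\varrho$ on $(\mathbb{C}^d)^{\otimes n}$ such that the operator $\mathcal{W}=W_1\otimes\cdots\otimes W_n$, where $W_i$ acts on the two copies of the $i$-th party, satisfies $$\operatorname{tr}\big(\mathcal{W}\,\varrho^{\otimes 2}\big)<0,$$ while $\operatorname{tr}\big(\mathcal{W}\,\varrho_{\mathrm{sep}}^{\otimes 2}\big)\ge 0$ for every separable $n$-partite state $\varrho_{\mathrm{sep}}$ on $(\mathbb{C}^d)^{\otimes n}$.
   Context: A state on a finite-dimensional Hilbert space is a positive semidefinite operator of trace one. An $n$-partite state $\varrho$ is (fully) separable if it is a finite convex combination of product states, $\varrho=\sum_i p_i\,\varrho_i^{(1)}\otimes\cdots\otimes\varrho_i^{(n)}$ with $p_i\ge 0$, $\sum_i p_i=1$ and each $\varrho_i^{(j)}$ a state; otherwise it is entangled. An entanglement witness on a tensor product space is a Hermitian operator $W$ such that $\operatorname{tr}(W\varrho_{\mathrm{sep}})\ge 0$ for all separable states and $\operatorname{tr}(W\varrho_{\mathrm{ent}})<0$ for at least one entangled state. Convention for evaluating $\operatorname{tr}(\mathcal{W}\varrho^{\otimes 2})$: the total space consists of two copies of each of the $n$ parties, indexed by (party $i$, copy $j$) with $1\le i\le n$, $j\in\{1,2\}$. The $j$-th tensor factor of $\varrho^{\otimes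 2}$ acts on the subsystems $(1,j),\dots,(n,j)$, and $W_i$ acts on the subsystems $(i,1),(i,2)$. For $n=3$ this reads $\operatorname{tr}\big((U_{AA'}\otimes V_{BB'}\otimes W_{CC'})(\varrho_{ABC}\otimes\varrho_{A'B'C'})\big)$. *)

theory Defs
  imports Complex_Main "HOL-Library.FuncSet"
begin

text \<open>
  An operator on the Hilbert space with orthonormal basis indexed by a finite set \<open>I\<close> is given by
  its matrix entries \<open>A x y\<close> for \<open>x, y \<in> I\<close>; entries outside \<open>I\<close> are never inspected.
  Index sets are used instead of initial segments of the naturals so that tensor factors can be
  referred to by name.
\<close>

type_synonym 'i operator = "'i \<Rightarrow> 'i \<Rightarrow> complex"

definition hermitian_op :: "'i set \<Rightarrow> 'i operator \<Rightarrow> bool" where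
  "hermitian_op I A \<longleftrightarrow> (\<forall>x\<in>I. \<forall>y\<in>I. A x y = cnj (A y x))"

definition psd_op :: "'i set \<Rightarrow> 'i operator \<Rightarrow> bool" where
  "psd_op I A \<longleftrightarrow> hermitian_op I A \<and>
     (\<forall>v :: 'i \<Rightarrow> complex. 0 \<le> Re (\<Sum>x\<in>I. \<Sum>y\<in>I. cnj (v x) * A x y * v y))"

definition trace_op :: "'i set \<Rightarrow> 'i operator \<Rightarrow> complex" where
  "trace_op I A = (\<Sum>x\<in>I. A x x)"

definition mult_op :: "'i set \<Rightarrow> 'i operator \<Rightarrow> 'i operator \<Rightarrow> 'i operator" where
  "mult_op I A B = (\<lambda>x y. \<Sum>z\<in>I. A x z * B z y)"

definition state :: "'i set \<Rightarrow> 'i operator \<Rightarrow> bool" where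
  "state I \<rho> \<longleftrightarrow> psd_op I \<rho> \<and> trace_op I \<rho> = 1"

text \<open>
  For a finite set \<open>S\<close> of subsystem labels, the product basis of the tensor product of one copy
  of \<open>\<complex>\<^sup>d\<close> for each \<open>s \<in> S\<close> is indexed by the maps from \<open>S\<close> to \<open>{..<d}\<close>.
\<close>

definition product_basis :: "'s set \<Rightarrow> nat \<Rightarrow> ('s \<Rightarrow> nat) set" where
  "product_basis S d = PiE S (\<lambda>_. {..<d})"

definition tensor_op :: "'s set \<Rightarrow> ('s \<Rightarrow> nat operator) \<Rightarrow> ('s \<Rightarrow> nat) operator" where
  "tensor_op S A = (\<lambda>x y. \<Prod>s\<in>S. A s (x s) (y s))"

definition separable :: "'s set \<Rightarrow> nat \<Rightarrow> ('s \<Rightarrow> nat) operator \<Rightarrow> bool" where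
  "separable S d \<rho> \<longleftrightarrow> state (product_basis S d) \<rho> \<and>
     (\<exists>(m :: nat) (p :: nat \<Rightarrow> real) (\<sigma> :: nat \<Rightarrow> 's \<Rightarrow> nat operator).
        (\<forall>k<m. 0 \<le> p k) \<and> (\<Sum>k<m. p k) = 1 \<and>
        (\<forall>k<m. \<forall>s\<in>S. state {..<d} (\<sigma> k s)) \<and>
        (\<forall>x\<in>product_basis S d. \<forall>y\<in>product_basis S d.
           \<rho> x y = (\<Sum>k<m. complex_of_real (p k) * tensor_op S (\<sigma> k) x y)))"

definition entangled :: "'s set \<Rightarrow> nat \<Rightarrow> ('s \<Rightarrow> nat) operator \<Rightarrow> bool" where
  "entangled S d \<rho> \<longleftrightarrow> state (product_basis S d) \<rho> \<and> \<not> separable S d \<rho>"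

text \<open>
  The trace of a product of two Hermitian operators is real, so taking real parts below loses
  nothing.
\<close>

definition expval :: "'i set \<Rightarrow> 'i operator \<Rightarrow> 'i operator \<Rightarrow> real" where
  "expval I W \<rho> = Re (trace_op I (mult_op I W \<rho>))"

definition entanglement_witness :: "'s set \<Rightarrow> nat \<Rightarrow> ('s \<Rightarrow> nat) operator \<Rightarrow> bool" where
  "entanglement_witness S d W \<longleftrightarrow> hermitian_op (product_basis S d) W \<and>
     (\<forall>\<rho>. separable S d \<rho> \<longrightarrow> 0 \<le> expval (product_basis S d) W \<rho>) \<and>
     (\<exists>\<rho>. entangled S d \<rho> \<and> expval (product_basis S d) W \<rho> < 0)"

text \<open>
  Two copies of \<open>n\<close> parties: the subsystems are the pairs (party, copy).  The \<open>i\<close>-th factor of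
  \<open>witness_product\<close> acts on all copies of party \<open>i\<close>, and the \<open>j\<close>-th factor of \<open>two_copies\<close>
  acts on the \<open>j\<close>-th copies of all parties.  The restricted abstractions make the sub-indices
  extensional, i.e. elements of the respective product basis.
\<close>

definition copies :: "nat set" where
  "copies = {1, 2}"

definition witness_product :: "nat \<Rightarrow> (nat \<Rightarrow> (nat \<Rightarrow> nat) operator) \<Rightarrow> (nat \<times> nat \<Rightarrow> nat) operator" where
  "witness_product n W = (\<lambda>x y. \<Prod>i\<in>{1..n}. W i (\<lambda>j\<in>copies. x (i, j)) (\<lambda>j\<in>copies. y (i, j)))"

definition two_copies :: "nat \<Rightarrow> (nat \<Rightarrow> nat) operator \<Rightarrow> (nat \<times> nat \<Rightarrow> nat) operator" where
  "two_copies n \<rho> = (\<lambda>x y. \<Prod>j\<in>copies. \<rho> (\<lambda>i\<in>{1..n}. x (i, j)) (\<lambda>i\<in>{1..n}. y (i, j)))"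

end

theory Submission imports Defs begin

text \<open>
  For a separable state with weights \<open>p\<^sub>k\<close> and factors \<open>\<sigma>\<^sub>k\<^sub>i\<close> the expectation value is the sum over
  \<open>k, l\<close> of \<open>p\<^sub>k p\<^sub>l\<close> times the product over \<open>i\<close> of \<open>tr (W\<^sub>i (\<sigma>\<^sub>k\<^sub>i \<otimes> \<sigma>\<^sub>l\<^sub>i))\<close>, hence nonnegative
  if each \<open>W\<^sub>i\<close> is nonnegative on product states.  Take
  \<open>W\<^sub>i = 1 - X \<otimes> X - Y \<otimes> Y\<close> on two qubits: the Bloch vectors give \<open>1 - x x' - y y' \<ge> 0\<close> on product
  states, whereas the value at the Bell state of \<open>|01\<rangle>\<close> and \<open>|10\<rangle>\<close> is \<open>-1\<close>.  On two copies
  of the three-qubit GHZ state, with matrix entries \<open>W(ab, a'b')\<close>, one finds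
  \<open>1/4 * (\<Sum> W(ab, a'b')^3) = 1/4 * (4 - 2 * 2^3) = -3\<close>.
  Negativity of the expectation values already shows that both states are entangled.
\<close>

subsection \<open>Sums over product bases\<close>

lemma finite_copies [simp]: "finite copies"
  by (simp add: copies_def)

lemma prod_copies: "prod f copies = f 1 * f 2"
  by (simp add: copies_def)

lemma finite_product_basis [simp]: "finite S \<Longrightarrow> finite (product_basis S d)"
  unfolding product_basis_def by (rule finite_PiE) auto

lemma product_basis_component: "x \<in> product_basis S d \<Longrightarrow> s \<in> S \<Longrightarrow> x s < d"
  by (auto simp: product_basis_def)

lemma restrict_mem_product_basis:
  "(\<And>s. s \<in> S \<Longrightarrow> f s < d) \<Longrightarrow> restrict f S \<in> product_basis S d"
  by (auto simp: product_basis_def)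

lemma product_basis_eq_restrict_iff:
  "x \<in> product_basis S d \<Longrightarrow> x = restrict f S \<longleftrightarrow> (\<forall>s\<in>S. x s = f s)"
  by (auto simp: product_basis_def PiE_def extensional_def fun_eq_iff restrict_def)

text \<open>Currying identifies an index over \<open>A \<times> B\<close> with a family over
  \<open>A\<close> of indices over \<open>B\<close>; the rest is distributivity of a finite product
  over sums.\<close>

lemma sum_product_basis_Times:
  fixes g :: "'a \<Rightarrow> ('b \<Rightarrow> nat) \<Rightarrow> complex"
  assumes "finite A" "finite B"
  shows "(\<Sum>x\<in>product_basis (A \<times> B) d. \<Prod>i\<in>A. g i (\<lambda>j\<in>B. x (i, j))) =
         (\<Prod>i\<in>A. \<Sum>u\<in>product_basis B d. g i u)"
proof -
  have "(\<Prod>i\<in>A. \<Sum>u\<in>product_basis B d. g i u) =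
        (\<Sum>X\<in>PiE A (\<lambda>_. product_basis B d). \<Prod>i\<in>A. g i (X i))"
    by (rule prod_sum_PiE) (use assms in auto)
  also have "\<dots> = (\<Sum>x\<in>product_basis (A \<times> B) d. \<Prod>i\<in>A. g i (\<lambda>j\<in>B. x (i, j)))"
  proof (rule sum.reindex_bij_witness
      [where i = "\<lambda>x. \<lambda>i\<in>A. \<lambda>j\<in>B. x (i, j)" and j = "\<lambda>X. \<lambda>p\<in>A \<times> B. X (fst p) (snd p)"])
    fix X assume X: "X \<in> PiE A (\<lambda>_. product_basis B d)"
    \<comment> \<open>Indices are extensional, so restricting again changes nothing.\<close>
    have Xi: "(\<lambda>j\<in>B. X i j) = X i" if "i \<in> A" for i
      using X that by (force simp: product_basis_def PiE_def extensional_def fun_eq_iff restrict_def)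
    show "(\<lambda>i\<in>A. \<lambda>j\<in>B. (\<lambda>p\<in>A \<times> B. X (fst p) (snd p)) (i, j)) = X"
    proof
      fix i
      show "(\<lambda>i\<in>A. \<lambda>j\<in>B. (\<lambda>p\<in>A \<times> B. X (fst p) (snd p)) (i, j)) i = X i"
        using X Xi by (cases "i \<in> A") (auto simp: PiE_def extensional_def cong: restrict_cong)
    qed
    show "(\<lambda>p\<in>A \<times> B. X (fst p) (snd p)) \<in> product_basis (A \<times> B) d"
      using X by (force simp: product_basis_def)
    show "(\<Prod>i\<in>A. g i (\<lambda>j\<in>B. (\<lambda>p\<in>A \<times> B. X (fst p) (snd p)) (i, j))) = (\<Prod>i\<in>A. g i (X i))"
      using Xi by (intro prod.cong) (auto cong: restrict_cong)
  next
    fix x assume x: "x \<in> product_basis (A \<times> B) d"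
    show "(\<lambda>p\<in>A \<times> B. (\<lambda>i\<in>A. \<lambda>j\<in>B. x (i, j)) (fst p) (snd p)) = x"
      using x by (auto simp: product_basis_def PiE_def extensional_def fun_eq_iff restrict_def)
    show "(\<lambda>i\<in>A. \<lambda>j\<in>B. x (i, j)) \<in> PiE A (\<lambda>_. product_basis B d)"
      using x by (auto simp: product_basis_def)
  qed
  finally show ?thesis ..
qed

subsection \<open>The quadratic form of a product of witnesses\<close>

lemma trace_mult_op_linear:
  assumes "\<forall>x\<in>I. \<forall>y\<in>I. \<rho> x y = (\<Sum>k\<in>K. c k * T k x y)"
  shows "trace_op I (mult_op I W \<rho>) = (\<Sum>k\<in>K. c k * trace_op I (mult_op I W (T k)))"
proof -
  have "trace_op I (mult_op I W \<rho>) = (\<Sum>x\<in>I. \<Sum>z\<in>I. \<Sum>k\<in>K. c k * (W x z * T k z x))"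
    unfolding trace_op_def mult_op_def using assms
    by (intro sum.cong refl) (simp add: sum_distrib_left mult_ac)
  also have "\<dots> = (\<Sum>x\<in>I. \<Sum>k\<in>K. \<Sum>z\<in>I. c k * (W x z * T k z x))"
    by (intro sum.cong refl sum.swap)
  also have "\<dots> = (\<Sum>k\<in>K. \<Sum>x\<in>I. \<Sum>z\<in>I. c k * (W x z * T k z x))"
    by (rule sum.swap)
  finally show ?thesis
    by (simp add: trace_op_def mult_op_def sum_distrib_left)
qed

text \<open>Once the second operator is also grouped by party, each summand of the trace is a
  product over parties, and the two index sums factor one after the other.\<close>

lemma trace_witness_product_tensor:
  "trace_op (product_basis ({1..n} \<times> copies) d)
     (mult_op (product_basis ({1..n} \<times> copies) d) (witness_product n W)
       (\<lambda>x y. \<Prod>i\<in>{1..n}. T i (\<lambda>j\<in>copies. x (i, j)) (\<lambda>j\<in>copies. y (i, j)))) =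
   (\<Prod>i\<in>{1..n}. trace_op (product_basis copies d) (mult_op (product_basis copies d) (W i) (T i)))"
proof -
  let ?P = "product_basis ({1..n} \<times> copies) d" and ?C = "product_basis copies d"
  have "(\<Sum>x\<in>?P. \<Sum>z\<in>?P. \<Prod>i\<in>{1..n}.
           W i (\<lambda>j\<in>copies. x (i, j)) (\<lambda>j\<in>copies. z (i, j)) *
           T i (\<lambda>j\<in>copies. z (i, j)) (\<lambda>j\<in>copies. x (i, j))) =
        (\<Sum>x\<in>?P. \<Prod>i\<in>{1..n}. \<Sum>w\<in>?C.
           W i (\<lambda>j\<in>copies. x (i, j)) w * T i w (\<lambda>j\<in>copies. x (i, j)))"
  proof (rule sum.cong[OF refl])
    fix x
    show "(\<Sum>z\<in>?P. \<Prod>i\<in>{1..n}.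
             W i (\<lambda>j\<in>copies. x (i, j)) (\<lambda>j\<in>copies. z (i, j)) *
             T i (\<lambda>j\<in>copies. z (i, j)) (\<lambda>j\<in>copies. x (i, j))) =
          (\<Prod>i\<in>{1..n}. \<Sum>w\<in>?C.
             W i (\<lambda>j\<in>copies. x (i, j)) w * T i w (\<lambda>j\<in>copies. x (i, j)))"
      by (rule sum_product_basis_Times
          [where g = "\<lambda>i w. W i (\<lambda>j\<in>copies. x (i, j)) w * T i w (\<lambda>j\<in>copies. x (i, j))"]) auto
  qed
  also have "\<dots> = (\<Prod>i\<in>{1..n}. \<Sum>u\<in>?C. \<Sum>w\<in>?C. W i u w * T i w u)"
    by (rule sum_product_basis_Times[where g = "\<lambda>i u. \<Sum>w\<in>?C. W i u w * T i w u"]) auto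
  finally show ?thesis
    by (simp add: trace_op_def mult_op_def witness_product_def prod.distrib)
qed

text \<open>Bilinear expansion in the two copies. Coefficients and factors are arbitrary complex, so
  this serves both separable decompositions and the expansion of \<open>ghz\<close> into matrix
  units, which are not all states.\<close>

lemma trace_witness_product_two_copies:
  assumes \<rho>: "\<forall>x\<in>product_basis {1..n} d. \<forall>y\<in>product_basis {1..n} d.
                \<rho> x y = (\<Sum>k\<in>K. c k * tensor_op {1..n} (\<sigma> k) x y)"
  shows "trace_op (product_basis ({1..n} \<times> copies) d)
           (mult_op (product_basis ({1..n} \<times> copies) d) (witness_product n W) (two_copies n \<rho>)) =
         (\<Sum>(k, l)\<in>K \<times> K. c k * c l * (\<Prod>i\<in>{1..n}. trace_op (product_basis copies d)
           (mult_op (product_basis copies d) (W i)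
             (tensor_op copies (\<lambda>j. if j = 1 then \<sigma> k i else \<sigma> l i)))))"
proof -
  let ?P = "product_basis ({1..n} \<times> copies) d"
  define T where "T = (\<lambda>k l i. tensor_op copies (\<lambda>j. if j = 1 then \<sigma> k i else \<sigma> l i))"
  have slice: "(\<lambda>i\<in>{1..n}. x (i, j)) \<in> product_basis {1..n} d" if "x \<in> ?P" "j \<in> copies" for x j
    using that by (auto simp: product_basis_def)
  have "two_copies n \<rho> x y = (\<Sum>p\<in>K \<times> K. c (fst p) * c (snd p) *
      (\<Prod>i\<in>{1..n}. T (fst p) (snd p) i (\<lambda>j\<in>copies. x (i, j)) (\<lambda>j\<in>copies. y (i, j))))"
    if "x \<in> ?P" "y \<in> ?P" for x y
  proof -
    \<comment> \<open>Regrouping from copies to parties: the first copy contributes term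
      \<open>k\<close>, the second term \<open>l\<close>.\<close>
    have T: "T k l i (\<lambda>j\<in>copies. x (i, j)) (\<lambda>j\<in>copies. y (i, j)) =
        \<sigma> k i (x (i, 1)) (y (i, 1)) * \<sigma> l i (x (i, 2)) (y (i, 2))" for k l i
      by (simp add: T_def tensor_op_def prod_copies) (simp add: copies_def)
    have "two_copies n \<rho> x y =
        (\<Sum>k\<in>K. c k * (\<Prod>i\<in>{1..n}. \<sigma> k i (x (i, 1)) (y (i, 1)))) *
        (\<Sum>l\<in>K. c l * (\<Prod>i\<in>{1..n}. \<sigma> l i (x (i, 2)) (y (i, 2))))"
      using \<rho> slice[OF that(1)] slice[OF that(2)]
      by (simp add: two_copies_def prod_copies tensor_op_def copies_def)
    also have "\<dots> = (\<Sum>k\<in>K. \<Sum>l\<in>K. c k * c l *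
        (\<Prod>i\<in>{1..n}. T k l i (\<lambda>j\<in>copies. x (i, j)) (\<lambda>j\<in>copies. y (i, j))))"
      unfolding sum_product T prod.distrib by (intro sum.cong refl) (simp add: mult_ac)
    finally show ?thesis
      by (simp add: sum.cartesian_product case_prod_unfold)
  qed
  moreover have "trace_op ?P (mult_op ?P (witness_product n W)
        (\<lambda>x y. \<Prod>i\<in>{1..n}. T k l i (\<lambda>j\<in>copies. x (i, j)) (\<lambda>j\<in>copies. y (i, j)))) =
      (\<Prod>i\<in>{1..n}. trace_op (product_basis copies d) (mult_op (product_basis copies d) (W i) (T k l i)))"
    for k l
    by (rule trace_witness_product_tensor)
  ultimately have "trace_op ?P (mult_op ?P (witness_product n W) (two_copies n \<rho>)) =
      (\<Sum>p\<in>K \<times> K. c (fst p) * c (snd p) * (\<Prod>i\<in>{1..n}. trace_op (product_basis copies d)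
        (mult_op (product_basis copies d) (W i) (T (fst p) (snd p) i))))"
    \<comment> \<open>Linearity is applied with the pair of term indices as one summation
      index.\<close>
    by (subst trace_mult_op_linear[where K = "K \<times> K" and c = "\<lambda>p. c (fst p) * c (snd p)" and
          T = "\<lambda>p x y. \<Prod>i\<in>{1..n}. T (fst p) (snd p) i (\<lambda>j\<in>copies. x (i, j)) (\<lambda>j\<in>copies. y (i, j))"])
       simp_all
  then show ?thesis
    by (simp add: T_def case_prod_unfold)
qed

section \<open>Nonnegativity on separable states\<close>

lemma hermitian_opD: "hermitian_op I A \<Longrightarrow> x \<in> I \<Longrightarrow> y \<in> I \<Longrightarrow> cnj (A x y) = A y x"
  unfolding hermitian_op_def by (metis complex_cnj_cnj)

lemma hermitian_tensor_op:
  assumes "\<forall>s\<in>S. hermitian_op {..<d} (\<sigma> s)"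
  shows "hermitian_op (product_basis S d) (tensor_op S \<sigma>)"
  unfolding hermitian_op_def[of "product_basis S d"] tensor_op_def cnj_prod
  using assms
  by (intro ballI prod.cong refl hermitian_opD[where I = "{..<d}", symmetric])
     (auto simp: product_basis_component)

text \<open>Conjugation merely swaps the two summation indices. Realness matters because
  \<open>expval\<close> keeps only real parts, which do not commute with products of complex
  traces.\<close>

lemma trace_mult_hermitian_real:
  assumes "hermitian_op I A" "hermitian_op I B"
  shows "trace_op I (mult_op I A B) = of_real (expval I A B)"
proof -
  have "cnj (\<Sum>x\<in>I. \<Sum>z\<in>I. A x z * B z x) = (\<Sum>x\<in>I. \<Sum>z\<in>I. A z x * B x z)"
    unfolding cnj_sum complex_cnj_mult
    using assms by (intro sum.cong refl) (simp add: hermitian_opD)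
  also have "\<dots> = (\<Sum>x\<in>I. \<Sum>z\<in>I. A x z * B z x)"
    by (rule sum.swap)
  finally have "trace_op I (mult_op I A B) \<in> \<real>"
    by (simp add: trace_op_def mult_op_def Reals_cnj_iff)
  then show ?thesis
    by (simp add: expval_def)
qed

text \<open>Block positivity, phrased with mixed factors so that it applies directly to the terms of
  a separable decomposition.\<close>

definition nonneg_on_products :: "'s set \<Rightarrow> nat \<Rightarrow> ('s \<Rightarrow> nat) operator \<Rightarrow> bool" where
  "nonneg_on_products S d W \<longleftrightarrow>
     (\<forall>\<sigma>. (\<forall>s\<in>S. state {..<d} (\<sigma> s)) \<longrightarrow> 0 \<le> expval (product_basis S d) W (tensor_op S \<sigma>))"

lemma expval_separable_nonneg:
  assumes W: "nonneg_on_products S d W" and sep: "separable S d \<rho>"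
  shows "0 \<le> expval (product_basis S d) W \<rho>"
proof -
  obtain m p \<sigma> where p: "\<forall>k<m. (0::real) \<le> p k"
    and \<sigma>: "\<forall>k<(m::nat). \<forall>s\<in>S. state {..<d} (\<sigma> k s)"
    and \<rho>: "\<forall>x\<in>product_basis S d. \<forall>y\<in>product_basis S d.
           \<rho> x y = (\<Sum>k<m. complex_of_real (p k) * tensor_op S (\<sigma> k) x y)"
    using sep unfolding separable_def by blast
  have "expval (product_basis S d) W \<rho> =
      (\<Sum>k<m. p k * expval (product_basis S d) W (tensor_op S (\<sigma> k)))"
    unfolding expval_def trace_mult_op_linear[OF \<rho>] by simp
  also have "\<dots> \<ge> 0"
    using p \<sigma> W by (auto simp: nonneg_on_products_def intro!: sum_nonneg mult_nonneg_nonneg)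
  finally show ?thesis .
qed

text \<open>The cross terms \<open>k \<noteq> l\<close> mix factors of different product states, but
  for each party these still form a product state of the two copies, so every term is
  nonnegative.\<close>

lemma expval_two_copies_separable_nonneg:
  assumes W: "\<forall>i\<in>{1..n}. hermitian_op (product_basis copies d) (W i) \<and> nonneg_on_products copies d (W i)"
    and sep: "separable {1..n} d \<rho>"
  shows "0 \<le> expval (product_basis ({1..n} \<times> copies) d) (witness_product n W) (two_copies n \<rho>)"
proof -
  obtain m p \<sigma> where p: "\<forall>k<m. (0::real) \<le> p k"
    and \<sigma>: "\<forall>k<(m::nat). \<forall>i\<in>{1..n}. state {..<d} (\<sigma> k i)"
    and \<rho>: "\<forall>x\<in>product_basis {1..n} d. \<forall>y\<in>product_basis {1..n} d.
           \<rho> x y = (\<Sum>k<m. complex_of_real (p k) * tensor_op {1..n} (\<sigma> k) x y)"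
    using sep unfolding separable_def by blast
  define E where "E = (\<lambda>k l i. expval (product_basis copies d) (W i)
      (tensor_op copies (\<lambda>j. if j = 1 then \<sigma> k i else \<sigma> l i)))"
  have real: "trace_op (product_basis copies d) (mult_op (product_basis copies d) (W i)
      (tensor_op copies (\<lambda>j. if j = 1 then \<sigma> k i else \<sigma> l i))) = of_real (E k l i)"
    if "k < m" "l < m" "i \<in> {1..n}" for k l i
    unfolding E_def using that \<sigma> W
    by (intro trace_mult_hermitian_real hermitian_tensor_op) (auto simp: state_def psd_op_def)
  have prod_real: "(\<Prod>i\<in>{1..n}. trace_op (product_basis copies d) (mult_op (product_basis copies d) (W i)
      (tensor_op copies (\<lambda>j. if j = 1 then \<sigma> k i else \<sigma> l i)))) = of_real (\<Prod>i\<in>{1..n}. E k l i)"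
    if "k < m" "l < m" for k l
    unfolding of_real_prod by (intro prod.cong refl real that)
  have E: "0 \<le> E k l i" if "k < m" "l < m" "i \<in> {1..n}" for k l i
    using that \<sigma> W by (auto simp: E_def nonneg_on_products_def)
  have "expval (product_basis ({1..n} \<times> copies) d) (witness_product n W) (two_copies n \<rho>) =
      Re (\<Sum>(k, l)\<in>{..<m} \<times> {..<m}. of_real (p k * p l * (\<Prod>i\<in>{1..n}. E k l i)))"
    unfolding expval_def trace_witness_product_two_copies[OF \<rho>]
    by (intro arg_cong[where f = Re] sum.cong refl) (auto simp: prod_real simp del: One_nat_def of_real_prod)
  also have "\<dots> = (\<Sum>(k, l)\<in>{..<m} \<times> {..<m}. p k * p l * (\<Prod>i\<in>{1..n}. E k l i))"
    by (simp add: case_prod_unfold del: of_real_prod)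
  also have "\<dots> \<ge> 0"
    using p E by (auto intro!: sum_nonneg mult_nonneg_nonneg prod_nonneg)
  finally show ?thesis .
qed

subsection \<open>Equal superpositions of two basis vectors\<close>

text \<open>For \<open>u \<noteq> v\<close>, the projector onto the normalized sum of the two basis
  vectors; it yields both the Bell and the GHZ state.\<close>

definition superposition :: "'i \<Rightarrow> 'i \<Rightarrow> 'i operator" where
  "superposition u v = (\<lambda>x y. if x \<in> {u, v} \<and> y \<in> {u, v} then 1 / 2 else 0)"

lemma sum_superposition:
  fixes f :: "'i \<Rightarrow> 'i \<Rightarrow> complex"
  assumes "finite I" "u \<in> I" "v \<in> I" "u \<noteq> v"
  shows "(\<Sum>x\<in>I. \<Sum>y\<in>I. f x y * superposition u v y x) = (f u u + f u v + f v u + f v v) / 2"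
proof -
  have "(\<Sum>x\<in>I. \<Sum>y\<in>I. f x y * superposition u v y x) =
        (\<Sum>x\<in>{u, v}. \<Sum>y\<in>{u, v}. f x y * superposition u v y x)"
    using assms
    by (intro sum.mono_neutral_cong_right) (auto simp: superposition_def intro!: sum.mono_neutral_cong_right)
  then show ?thesis
    using assms(4) by (simp add: superposition_def add_divide_distrib)
qed

text \<open>The quadratic form at \<open>w\<close> equals half the squared modulus of
  \<open>w u + w v\<close>.\<close>

lemma state_superposition:
  assumes "finite I" "u \<in> I" "v \<in> I" "u \<noteq> v"
  shows "state I (superposition u v)"
proof -
  have "0 \<le> Re (\<Sum>x\<in>I. \<Sum>y\<in>I. cnj (w x) * superposition u v x y * w y)" for w
  proof -
    \<comment> \<open>Symmetry of the matrix allows the transposition that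
      \<open>sum_superposition\<close> expects.\<close>
    have "(\<Sum>x\<in>I. \<Sum>y\<in>I. cnj (w x) * superposition u v x y * w y) =
        (\<Sum>x\<in>I. \<Sum>y\<in>I. (cnj (w x) * w y) * superposition u v y x)"
      by (intro sum.cong refl) (auto simp: superposition_def)
    also have "\<dots> = of_real ((cmod (w u + w v))\<^sup>2 / 2)"
      unfolding sum_superposition[OF assms]
      by (simp add: complex_norm_square algebra_simps del: of_real_power)
    finally have eq: "(\<Sum>x\<in>I. \<Sum>y\<in>I. cnj (w x) * superposition u v x y * w y) =
        of_real ((cmod (w u + w v))\<^sup>2 / 2)" .
    show ?thesis
      unfolding eq by simp
  qed
  moreover have "trace_op I (superposition u v) = (\<Sum>x\<in>{u, v}. 1 / 2)"
    unfolding trace_op_def using assms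
    by (intro sum.mono_neutral_cong_right) (auto simp: superposition_def)
  ultimately show ?thesis
    using assms(4) by (auto simp: state_def psd_op_def hermitian_op_def superposition_def)
qed

subsection \<open>A two-qubit witness\<close>

definition basis_pair :: "nat \<Rightarrow> nat \<Rightarrow> nat \<Rightarrow> nat" where
  "basis_pair a b = (\<lambda>j\<in>copies. if j = 1 then a else b)"

lemma basis_pair_simps [simp]: "basis_pair a b 1 = a" "basis_pair a b (Suc 0) = a" "basis_pair a b 2 = b"
  by (simp_all add: basis_pair_def copies_def)

lemma basis_pair_eq_iff [simp]: "basis_pair a b = basis_pair a' b' \<longleftrightarrow> a = a' \<and> b = b'"
proof
  assume "basis_pair a b = basis_pair a' b'"
  from fun_cong[OF this, of 1] fun_cong[OF this, of 2] show "a = a' \<and> b = b'"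
    by simp
qed simp

lemma product_basis_copies:
  "product_basis copies 2 = {basis_pair 0 0, basis_pair 0 1, basis_pair 1 0, basis_pair 1 1}"
proof
  show "product_basis copies 2 \<subseteq> {basis_pair 0 0, basis_pair 0 1, basis_pair 1 0, basis_pair 1 1}"
  proof
    fix x assume x: "x \<in> product_basis copies 2"
    then have "x = basis_pair (x 1) (x 2)"
      unfolding basis_pair_def by (subst product_basis_eq_restrict_iff) (auto simp: copies_def)
    moreover have "x 1 < 2" "x 2 < 2"
      using x by (auto simp: copies_def intro: product_basis_component)
    ultimately show "x \<in> {basis_pair 0 0, basis_pair 0 1, basis_pair 1 0, basis_pair 1 1}"
      by (auto simp: less_2_cases_iff)
  qed
  have "basis_pair a b \<in> product_basis copies 2" if "a < 2" "b < 2" for a b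
    unfolding basis_pair_def using that by (intro restrict_mem_product_basis) simp
  then show "{basis_pair 0 0, basis_pair 0 1, basis_pair 1 0, basis_pair 1 1} \<subseteq> product_basis copies 2"
    by simp
qed

text \<open>The matrix of \<open>1 - X \<otimes> X - Y \<otimes> Y\<close>: \<open>X \<otimes> X + Y \<otimes> Y\<close> exchanges \<open>|01\<rangle>\<close> and \<open>|10\<rangle>\<close> with
  coefficient \<open>2\<close> and annihilates \<open>|00\<rangle>\<close> and \<open>|11\<rangle>\<close>.\<close>

definition xy_witness :: "(nat \<Rightarrow> nat) operator" where
  "xy_witness x y = (if x = y then 1 else if x 1 = y 2 \<and> x 2 = y 1 then - 2 else 0)"

lemma trace_xy_witness_tensor:
  "trace_op (product_basis copies 2) (mult_op (product_basis copies 2) xy_witness (tensor_op copies \<sigma>)) =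
   (\<sigma> 1 0 0 + \<sigma> 1 1 1) * (\<sigma> 2 0 0 + \<sigma> 2 1 1) - 2 * (\<sigma> 1 0 1 * \<sigma> 2 1 0 + \<sigma> 1 1 0 * \<sigma> 2 0 1)"
  by (simp add: trace_op_def mult_op_def product_basis_copies xy_witness_def tensor_op_def
      prod_copies algebra_simps)

text \<open>In Bloch coordinates the entry has modulus half the length of the
  \<open>x\<close>-\<open>y\<close> part, so the bound confines that part to the unit disc. One test
  vector suffices to prove it.\<close>

lemma qubit_state_offdiag:
  fixes \<sigma> :: "nat operator"
  assumes "state {..<2} \<sigma>"
  shows "cmod (\<sigma> 0 1) \<le> 1 / 2"
proof -
  define z where "z = \<sigma> 0 1"
  have herm: "\<sigma> 1 0 = cnj z"
    using assms hermitian_opD[of "{..<2}" \<sigma> 0 1] by (simp add: z_def state_def psd_op_def)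
  have tr: "\<sigma> 0 0 + \<sigma> 1 1 = 1"
    using assms by (simp add: state_def trace_op_def numeral_2_eq_2)
  have pos: "0 \<le> Re (\<Sum>x<2. \<Sum>y<2. cnj (v x) * \<sigma> x y * v y)" for v
    using assms unfolding state_def psd_op_def by blast
  show ?thesis
  proof (cases "z = 0")
    case False
    \<comment> \<open>With the phase \<open>s\<close> of \<open>z\<close>, the test vector
      \<open>(-s, 1)\<close> turns both off-diagonal terms into \<open>- cmod z\<close>, leaving
      \<open>1 - 2 * cmod z\<close>. Since \<open>sgn 0 = 0\<close> is no phase,
      \<open>z = 0\<close> is treated apart.\<close>
    define s where "s = sgn z"
    have ss: "cnj s * s = 1"
      using False complex_norm_square[of s] by (simp add: s_def norm_sgn mult.commute)
    have sz: "z = of_real (cmod z) * s"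
      using False by (simp add: s_def sgn_eq)
    have "(\<Sum>x<2. \<Sum>y<2. cnj (if x = 0 then - s else 1) * \<sigma> x y * (if y = 0 then - s else 1)) =
        (cnj s * s) * \<sigma> 0 0 - cnj s * z - cnj z * s + \<sigma> 1 1"
      using herm by (simp add: numeral_2_eq_2 z_def algebra_simps)
    also have "cnj s * z = of_real (cmod z)"
      using ss by (subst sz) (simp add: mult.left_commute)
    also have "cnj z * s = of_real (cmod z)"
      using ss by (subst sz) (simp add: mult.assoc)
    also have "(cnj s * s) * \<sigma> 0 0 - of_real (cmod z) - of_real (cmod z) + \<sigma> 1 1 =
        of_real (1 - 2 * cmod z)"
      using tr ss by (simp add: algebra_simps)
    finally show ?thesis
      using pos[of "\<lambda>x. if x = 0 then - s else 1"] by (simp add: z_def)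
  qed (simp add: z_def)
qed

lemma nonneg_on_products_xy_witness: "nonneg_on_products copies 2 xy_witness"
  unfolding nonneg_on_products_def
proof (intro allI impI)
  fix \<sigma> :: "nat \<Rightarrow> nat operator"
  assume \<sigma>: "\<forall>s\<in>copies. state {..<2} (\<sigma> s)"
  have tr: "\<sigma> s 0 0 + \<sigma> s 1 1 = 1" and herm: "\<sigma> s 1 0 = cnj (\<sigma> s 0 1)"
    and le: "cmod (\<sigma> s 0 1) \<le> 1 / 2" if "s \<in> copies" for s
    using bspec[OF \<sigma> that] qubit_state_offdiag[of "\<sigma> s"] hermitian_opD[of "{..<2}" "\<sigma> s" 0 1]
    by (auto simp: state_def psd_op_def trace_op_def numeral_2_eq_2)
  have s: "1 \<in> copies" "2 \<in> copies"
    by (auto simp: copies_def)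
  \<comment> \<open>The expectation value becomes \<open>1 - 4 * Re ?t\<close>.\<close>
  let ?t = "\<sigma> 1 0 1 * cnj (\<sigma> 2 0 1)"
  have "Re ?t \<le> cmod ?t"
    by (rule complex_Re_le_cmod)
  also have "\<dots> \<le> 1 / 2 * (1 / 2)"
    unfolding norm_mult complex_mod_cnj using le s by (intro mult_mono) auto
  finally have "Re ?t \<le> 1 / 4"
    by simp
  then show "0 \<le> expval (product_basis copies 2) xy_witness (tensor_op copies \<sigma>)"
    unfolding expval_def trace_xy_witness_tensor tr[OF s(1)] tr[OF s(2)] herm[OF s(1)] herm[OF s(2)]
    by simp
qed

lemma hermitian_xy_witness: "hermitian_op I xy_witness"
  by (auto simp: hermitian_op_def xy_witness_def)

lemma entanglement_witness_xy_witness: "entanglement_witness copies 2 xy_witness"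
proof -
  let ?P = "product_basis copies 2"
  let ?bell = "superposition (basis_pair 0 1) (basis_pair 1 0)"
  have mem: "basis_pair 0 1 \<in> ?P" "basis_pair 1 0 \<in> ?P" "basis_pair 0 1 \<noteq> basis_pair 1 0"
    by (auto simp: product_basis_copies)
  \<comment> \<open>The four surviving entries give \<open>(1 - 2 - 2 + 1) / 2 = -1\<close>.\<close>
  have neg: "expval ?P xy_witness ?bell < 0"
    unfolding expval_def trace_op_def mult_op_def
    using mem by (simp add: sum_superposition) (simp add: xy_witness_def)
  then have "\<not> separable copies 2 ?bell"
    using expval_separable_nonneg[OF nonneg_on_products_xy_witness] by force
  then have "entangled copies 2 ?bell"
    using mem by (simp add: entangled_def state_superposition)
  with neg show ?thesis
    unfolding entanglement_witness_def
    using hermitian_xy_witness expval_separable_nonneg[OF nonneg_on_products_xy_witness] by blast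
qed

subsection \<open>The GHZ state\<close>

abbreviation ghz :: "(nat \<Rightarrow> nat) operator" where
  "ghz \<equiv> superposition (\<lambda>i\<in>{1..3}. 0) (\<lambda>i\<in>{1..3}. 1)"

lemma state_ghz: "state (product_basis {1..3} 2) ghz"
  by (rule state_superposition) (auto simp: fun_eq_iff intro!: restrict_mem_product_basis)

definition matrix_unit :: "nat \<times> nat \<Rightarrow> nat operator" where
  "matrix_unit p = (\<lambda>x y. if x = fst p \<and> y = snd p then 1 else 0)"

text \<open>This is no separable decomposition: the units with \<open>a \<noteq> b\<close> are not
  states, and the weights sum to \<open>2\<close>.\<close>

lemma ghz_eq_sum_tensor_op:
  assumes "x \<in> product_basis {1..3} 2" "y \<in> product_basis {1..3} 2"
  shows "ghz x y = (\<Sum>p\<in>{(0, 0), (0, 1), (1, 0), (1, 1)}. 1 / 2 * tensor_op {1..3} (\<lambda>_. matrix_unit p) x y)"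
proof -
  have "tensor_op {1..3::nat} (\<lambda>_. matrix_unit (a, b)) x y =
      (if x = (\<lambda>i\<in>{1..3}. a) \<and> y = (\<lambda>i\<in>{1..3}. b) then 1 else 0)" for a b
    unfolding product_basis_eq_restrict_iff[OF assms(1)] product_basis_eq_restrict_iff[OF assms(2)]
    by (auto simp: tensor_op_def matrix_unit_def)
  moreover have "(\<lambda>i\<in>{1..3::nat}. 0::nat) \<noteq> (\<lambda>i\<in>{1..3}. 1)"
    by (auto simp: fun_eq_iff)
  ultimately show ?thesis
    by (auto simp: superposition_def)
qed

text \<open>Each pair of matrix units contributes the cube of one two-qubit trace: \<open>1\<close>
  for the four diagonal pairs, \<open>-2\<close> for the two pairs of opposite off-diagonal units,
  \<open>0\<close> otherwise. The odd exponent preserves the negative sign.\<close>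

lemma expval_two_copies_ghz:
  "expval (product_basis ({1..3} \<times> copies) 2) (witness_product 3 (\<lambda>_. xy_witness)) (two_copies 3 ghz) = - 3"
proof -
  have "\<forall>x\<in>product_basis {1..3} 2. \<forall>y\<in>product_basis {1..3} 2.
      ghz x y = (\<Sum>p\<in>{(0, 0), (0, 1), (1, 0), (1, 1)}. 1 / 2 * tensor_op {1..3} (\<lambda>_. matrix_unit p) x y)"
    using ghz_eq_sum_tensor_op by blast
  from trace_witness_product_two_copies[OF this, of "\<lambda>_. xy_witness"]
  show ?thesis
    unfolding expval_def trace_xy_witness_tensor
    by (simp add: sum.cartesian_product[symmetric] matrix_unit_def)
qed

theorem mainTheorem1:
  "\<exists>(n :: nat) (d :: nat) (W :: nat \<Rightarrow> (nat \<Rightarrow> nat) operator) (\<rho> :: (nat \<Rightarrow> nat) operator).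
     3 \<le> n \<and> 2 \<le> d \<and>
     (\<forall>i\<in>{1..n}. entanglement_witness copies d (W i)) \<and>
     entangled {1..n} d \<rho> \<and>
     expval (product_basis ({1..n} \<times> copies) d) (witness_product n W) (two_copies n \<rho>) < 0 \<and>
     (\<forall>\<rho>sep. separable {1..n} d \<rho>sep \<longrightarrow>
        0 \<le> expval (product_basis ({1..n} \<times> copies) d) (witness_product n W) (two_copies n \<rho>sep))"
proof -
  have nonneg: "\<forall>\<rho>sep. separable {1..3} 2 \<rho>sep \<longrightarrow> 0 \<le> expval (product_basis ({1..3} \<times> copies) 2)
      (witness_product 3 (\<lambda>_. xy_witness)) (two_copies 3 \<rho>sep)"
    by (intro allI impI expval_two_copies_separable_nonneg)
      (auto intro: hermitian_xy_witness nonneg_on_products_xy_witness)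
  then have "entangled {1..3} 2 ghz"
    using state_ghz expval_two_copies_ghz by (force simp: entangled_def)
  with nonneg show ?thesis
    using entanglement_witness_xy_witness expval_two_copies_ghz
    by (intro exI[of _ 3] exI[of _ 2] exI[of _ "\<lambda>_. xy_witness"] exI[of _ ghz]) auto
qed

end
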